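(* Let $\Omega\subset\mathbb R^3$ be an unbounded domain with smooth boundary, and let $\Sigma$ be a connected, complete, noncompact, orientable, immersed free boundary minimal surface of finite Morse index in $\Omega$, with nonempty compact boundary $\partial\Sigma\subset\partial\Omega$, with ends of multiplicities $d_1,\dots,d_r$ corresponding to the punctures $p_1,\dots,p_r$ of its conformal compactification $\overline\Sigma$. Then the weight $$\rho(x)=\frac{1}{(1+|x|^2)\bigl(\log(2+|x|)\bigr)^2},\qquad x\in\mathbb R^3,$$ restricted to $\Sigma$, is admissible, with local orders $N_j=d_j+1$ at every puncture $p_j$.
   Context: Free boundary: $\Sigma$ is immersed in $\overline\Omega$ (position map $X$) and meets $\partial\Omega$ exactly along $\partial\Sigma$, orthogonally. Let $\eta$ be the outward unit normal of $\partial\Omega$, $\mathrm{II}_{\partial\Omega}(Y,Z)=\langle D_Y\eta,Z\rangle$, $N$ a unit normal of $\Sigma$, $A(Y)=D_YN$. The Morse index is the supremum of the dimensions of subspaces of $C_c^\infty(\Sigma)$ (functions not required to vanish on $\partial\Sigma$) on which $\mathcal Q(\phi,\phi)=\int_\Sigma(|\nabla\phi|^2-|A|^2\phi^2)\,d\mu-\int_{\partial\Sigma}\mathrm{II}_{\partial\Omega}(N,N)\phi^2\,d\sigma$ is negative definite. Structure and multiplicities: by a known theorem (Hong–Saturnino), finite index implies that $\Sigma$ is conformally $\overline\Sigma\setminus\{p_1,\dots,p_r\}$, where $\overline\Sigma$ is a compact Riemann surface with boundary $\partial\overline\Sigma=\partial\Sigma$ and the $p_j$ are interior points, one for each end; $\Sigma$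 has finite total curvature and is properly immersed. In a holomorphic coordinate $z$ centered at $p_j$ there is an integer $d_j\ge1$, the multiplicity of the $j$-th end, such that $|X(z)|\asymp|z|^{-d_j}$ and the induced metric is $\lambda_j(z)^2|dz|^2$ with $\lambda_j(z)\asymp|z|^{-(d_j+1)}$ as $z\to0$ ($a\asymp b$: the quotient is bounded above and below by positive constants). Admissible weights: for each $j$ fix a holomorphic coordinate $z$ centered at $p_j$ on a coordinate disk $D_j\subset\overline\Sigma\setminus\partial\overline\Sigma$, the $D_j$ pairwise disjoint, and $R_1>0$ with $\{|z|\le R_1\}\subset D_j$ for every $j$. A continuous $\rho:\Sigma\to\mathbb R_{>0}$ is admissible if: (a) $\rho$ is bounded on $\Sigma$ and bounded away from $0$ on $\overline\Sigma\setminus\bigcup_jD_j$; (b) there are constants $0<c\le C$ and positive measurable functions $\varrho_j$ on $(0,R_1]$ with $c\,\varrho_j(|z|)\le\rho(z)\le C\,\varrho_j(|z|)$ on $\{0<|z|\le R_1\}\subset D_j\setminus\{p_j\}$; (c) for every $j$ the local order $N_j:=\max\{m\in\mathbb Z_{\ge0}:\int_0^{R_1}r^{-2m}\varrho_j(r)\,r\,dr<\infty\}$ is finite. *)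

theory Defs
  imports "HOL-Analysis.Analysis" "HOL-Library.Function_Algebras" "HOL-Library.Landau_Symbols"
begin

unbundle no cross3_syntax

subsection \<open>Smooth maps\<close>

primrec Ck :: "nat \<Rightarrow> ('a::real_normed_vector \<Rightarrow> 'b::real_normed_vector) \<Rightarrow> 'a set \<Rightarrow> bool" where
  "Ck 0 f W \<longleftrightarrow> continuous_on W f"
| "Ck (Suc n) f W \<longleftrightarrow> (\<forall>x\<in>W. f differentiable (at x)) \<and>
     (\<forall>v. Ck n (\<lambda>x. frechet_derivative f (at x) v) W)"

definition smooth_on :: "('a::real_normed_vector \<Rightarrow> 'b::real_normed_vector) \<Rightarrow> 'a set \<Rightarrow> bool" where
  "smooth_on f W \<longleftrightarrow> open W \<and> (\<forall>n. Ck n f W)"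

text \<open>
  Regularity of a map on a set \<open>V\<close> that need not be open (a relatively open subset of the closed
  half-plane): near every point of \<open>V\<close> the map has an extension of the required class to an
  open set of the plane.
\<close>

definition locally_extends ::
    "((complex \<Rightarrow> 'b) \<Rightarrow> complex set \<Rightarrow> bool) \<Rightarrow> (complex \<Rightarrow> 'b) \<Rightarrow> complex set \<Rightarrow> bool" where
  "locally_extends P f V \<longleftrightarrow>
     (\<forall>w\<in>V. \<exists>W g. open W \<and> w \<in> W \<and> P g W \<and> (\<forall>v\<in>W \<inter> V. g v = f v))"

subsection \<open>Surfaces with boundary\<close>

text \<open>A chart is a domain together with a coordinate map; only the values on the domain matter.
  Boundary charts and interior charts alike take values in the closed upper half-plane.\<close>

type_synonym 'a chart = "'a set \<times> ('a \<Rightarrow> complex)"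

definition half_plane :: "complex set" where
  "half_plane = {w. Im w \<ge> 0}"

definition chart_on :: "'a topology \<Rightarrow> complex set \<Rightarrow> 'a chart \<Rightarrow> bool" where
  "chart_on S M = (\<lambda>(U, \<phi>). openin S U \<and> openin (top_of_set M) (\<phi> ` U) \<and>
     homeomorphic_map (subtopology S U) (top_of_set (\<phi> ` U)) \<phi>)"

definition transition_ok ::
    "((complex \<Rightarrow> complex) \<Rightarrow> complex set \<Rightarrow> bool) \<Rightarrow> 'a chart \<Rightarrow> 'a chart \<Rightarrow> bool" where
  "transition_ok P = (\<lambda>(U, \<phi>) (V, \<psi>). locally_extends P (\<psi> \<circ> inv_into U \<phi>) (\<phi> ` (U \<inter> V)))"

definition compatible ::
    "((complex \<Rightarrow> complex) \<Rightarrow> complex set \<Rightarrow> bool) \<Rightarrow> 'a chart \<Rightarrow> 'a chart \<Rightarrow> bool" where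
  "compatible P c c' \<longleftrightarrow> transition_ok P c c' \<and> transition_ok P c' c"

definition surface_with_boundary ::
    "((complex \<Rightarrow> complex) \<Rightarrow> complex set \<Rightarrow> bool) \<Rightarrow> 'a topology \<Rightarrow> 'a chart set \<Rightarrow> bool" where
  "surface_with_boundary P S A \<longleftrightarrow>
     Hausdorff_space S \<and> second_countable S \<and>
     topspace S = (\<Union>c\<in>A. fst c) \<and>
     (\<forall>c\<in>A. chart_on S half_plane c) \<and>
     (\<forall>c\<in>A. \<forall>c'\<in>A. compatible P c c')"

abbreviation smooth_surface :: "'a topology \<Rightarrow> 'a chart set \<Rightarrow> bool" where
  "smooth_surface \<equiv> surface_with_boundary smooth_on"

abbreviation riemann_surface :: "'a topology \<Rightarrow> 'a chart set \<Rightarrow> bool" where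
  "riemann_surface \<equiv> surface_with_boundary (\<lambda>f W. f holomorphic_on W)"

definition surface_boundary :: "'a chart set \<Rightarrow> 'a set" where
  "surface_boundary A = {p. \<exists>c\<in>A. p \<in> fst c \<and> Im (snd c p) = 0}"

definition smooth_map :: "'a chart set \<Rightarrow> ('a \<Rightarrow> 'b::real_normed_vector) \<Rightarrow> bool" where
  "smooth_map A f \<longleftrightarrow> (\<forall>(U, \<phi>)\<in>A. locally_extends smooth_on (f \<circ> inv_into U \<phi>) (\<phi> ` U))"

text \<open>The differential of \<open>f\<close> at \<open>p\<close>, with tangent vectors written in the coordinates of the
  chart. The derivative within a relatively open subset of the half-plane is unique.\<close>

definition chart_deriv ::
    "'a chart \<Rightarrow> ('a \<Rightarrow> 'b::real_normed_vector) \<Rightarrow> 'a \<Rightarrow> complex \<Rightarrow> 'b" where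
  "chart_deriv c f p =
     frechet_derivative (f \<circ> inv_into (fst c) (snd c)) (at (snd c p) within snd c ` fst c)"

text \<open>\<open>Im (cnj (L 1) * L \<i>)\<close> is the determinant of a real linear map \<open>L\<close> of the plane.\<close>

definition orientable_surface :: "'a topology \<Rightarrow> 'a chart set \<Rightarrow> bool" where
  "orientable_surface S A \<longleftrightarrow>
     (\<exists>B. smooth_surface S B \<and> (\<forall>b\<in>B. \<forall>c\<in>A. compatible smooth_on b c) \<and>
          (\<forall>b\<in>B. \<forall>c\<in>B. \<forall>p \<in> fst b \<inter> fst c.
             Im (cnj (chart_deriv b (snd c) p 1) * chart_deriv b (snd c) p \<i>) > 0))"

subsection \<open>Immersed surfaces in space\<close>

definition immersion :: "'a chart set \<Rightarrow> ('a \<Rightarrow> real^3) \<Rightarrow> bool" where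
  "immersion A X \<longleftrightarrow> smooth_map A X \<and> (\<forall>c\<in>A. \<forall>p\<in>fst c. inj (chart_deriv c X p))"

definition unit_normal :: "'a chart set \<Rightarrow> ('a \<Rightarrow> real^3) \<Rightarrow> ('a \<Rightarrow> real^3) \<Rightarrow> bool" where
  "unit_normal A X N \<longleftrightarrow> smooth_map A N \<and>
     (\<forall>c\<in>A. \<forall>p\<in>fst c. norm (N p) = 1 \<and> (\<forall>v. N p \<bullet> chart_deriv c X p v = 0))"

definition orthonormal_frame ::
    "'a chart \<Rightarrow> ('a \<Rightarrow> real^3) \<Rightarrow> 'a \<Rightarrow> complex \<Rightarrow> complex \<Rightarrow> bool" where
  "orthonormal_frame c X p a b \<longleftrightarrow>
     norm (chart_deriv c X p a) = 1 \<and> norm (chart_deriv c X p b) = 1 \<and>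
     chart_deriv c X p a \<bullet> chart_deriv c X p b = 0"

text \<open>Trace, with respect to the induced metric, of the quadratic form on the tangent plane at
  \<open>p\<close> that is given by \<open>q c\<close> in the chart \<open>c\<close>.\<close>

definition metric_trace ::
    "'a chart set \<Rightarrow> ('a \<Rightarrow> real^3) \<Rightarrow> 'a \<Rightarrow> ('a chart \<Rightarrow> complex \<Rightarrow> real) \<Rightarrow> real" where
  "metric_trace A X p q =
     (THE s. \<exists>c\<in>A. p \<in> fst c \<and> (\<exists>a b. orthonormal_frame c X p a b \<and> s = q c a + q c b))"

definition mean_curvature ::
    "'a chart set \<Rightarrow> ('a \<Rightarrow> real^3) \<Rightarrow> ('a \<Rightarrow> real^3) \<Rightarrow> 'a \<Rightarrow> real" where
  "mean_curvature A X N p =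
     metric_trace A X p (\<lambda>c v. chart_deriv c N p v \<bullet> chart_deriv c X p v)"

definition shape_norm2 ::
    "'a chart set \<Rightarrow> ('a \<Rightarrow> real^3) \<Rightarrow> ('a \<Rightarrow> real^3) \<Rightarrow> 'a \<Rightarrow> real" where
  "shape_norm2 A X N p = metric_trace A X p (\<lambda>c v. (norm (chart_deriv c N p v))\<^sup>2)"

definition gradient_norm2 ::
    "'a chart set \<Rightarrow> ('a \<Rightarrow> real^3) \<Rightarrow> ('a \<Rightarrow> real) \<Rightarrow> 'a \<Rightarrow> real" where
  "gradient_norm2 A X f p = metric_trace A X p (\<lambda>c v. (chart_deriv c f p v)\<^sup>2)"

definition surface_borel :: "'a topology \<Rightarrow> 'a set set" where
  "surface_borel S = sigma_sets (topspace S) {U. openin S U}"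

definition area_measure :: "'a topology \<Rightarrow> 'a chart set \<Rightarrow> ('a \<Rightarrow> real^3) \<Rightarrow> 'a measure" where
  "area_measure S A X = (THE \<mu>. space \<mu> = topspace S \<and> sets \<mu> = surface_borel S \<and>
     (\<forall>(U, \<phi>)\<in>A. \<forall>B\<in>surface_borel S. B \<subseteq> U \<longrightarrow>
        emeasure \<mu> B =
          (\<integral>\<^sup>+ w\<in>\<phi> ` B. ennreal (norm (cross3 (chart_deriv (U, \<phi>) X (inv_into U \<phi> w) 1)
                                        (chart_deriv (U, \<phi>) X (inv_into U \<phi> w) \<i>))) \<partial>lborel)))"

text \<open>Arc length along the boundary, as a measure on the whole surface that is concentrated on
  the boundary: in a chart, the boundary is the part with real coordinate.\<close>

definition boundary_measure :: "'a topology \<Rightarrow> 'a chart set \<Rightarrow> ('a \<Rightarrow> real^3) \<Rightarrow> 'a measure" where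
  "boundary_measure S A X = (THE \<sigma>. space \<sigma> = topspace S \<and> sets \<sigma> = surface_borel S \<and>
     (\<forall>(U, \<phi>)\<in>A. \<forall>B\<in>surface_borel S. B \<subseteq> U \<longrightarrow>
        emeasure \<sigma> B =
          (\<integral>\<^sup>+ t\<in>{t. complex_of_real t \<in> \<phi> ` B}.
             ennreal (norm (chart_deriv (U, \<phi>) X (inv_into U \<phi> (complex_of_real t)) 1)) \<partial>lborel)))"

text \<open>The length of a curve in the induced metric is the length of its image in space. Requiring
  the speed to have an integral excludes curves of infinite length.\<close>

definition intrinsic_dist :: "'a topology \<Rightarrow> ('a \<Rightarrow> real^3) \<Rightarrow> 'a \<Rightarrow> 'a \<Rightarrow> real" where
  "intrinsic_dist S X p q = Inf {l. \<exists>\<gamma>. pathin S \<gamma> \<and> valid_path (X \<circ> \<gamma>) \<and> \<gamma> 0 = p \<and> \<gamma> 1 = q \<and>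
     ((\<lambda>t. norm (vector_derivative (X \<circ> \<gamma>) (at t))) has_integral l) {0..1}}"

definition complete_surface :: "'a topology \<Rightarrow> ('a \<Rightarrow> real^3) \<Rightarrow> bool" where
  "complete_surface S X \<longleftrightarrow> Metric_space.mcomplete (topspace S) (intrinsic_dist S X)"

subsection \<open>Domains with smooth boundary\<close>

definition local_defining_function ::
    "(real^3) set \<Rightarrow> real^3 \<Rightarrow> (real^3 \<Rightarrow> real) \<Rightarrow> real^3 \<Rightarrow> bool" where
  "local_defining_function \<Omega> y f g \<longleftrightarrow>
     (\<exists>W. open W \<and> y \<in> W \<and> smooth_on f W \<and> \<Omega> \<inter> W = {x\<in>W. f x < 0} \<and>
          frontier \<Omega> \<inter> W = {x\<in>W. f x = 0}) \<and>
     GDERIV f y :> g \<and> g \<noteq> 0"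

definition smooth_domain :: "(real^3) set \<Rightarrow> bool" where
  "smooth_domain \<Omega> \<longleftrightarrow> open \<Omega> \<and> connected \<Omega> \<and> \<Omega> \<noteq> {} \<and>
     (\<forall>y\<in>frontier \<Omega>. \<exists>f g. local_defining_function \<Omega> y f g)"

definition outward_normal :: "(real^3) set \<Rightarrow> real^3 \<Rightarrow> real^3" where
  "outward_normal \<Omega> y = (THE n. \<exists>f g. local_defining_function \<Omega> y f g \<and> n = g /\<^sub>R norm g)"

text \<open>A derivative within the surface \<open>frontier \<Omega>\<close> is determined only on vectors tangent to it,
  so this is meaningful for tangent \<open>Y\<close>.\<close>

definition second_fundamental_form ::
    "(real^3) set \<Rightarrow> real^3 \<Rightarrow> real^3 \<Rightarrow> real^3 \<Rightarrow> real" where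
  "second_fundamental_form \<Omega> y Y Z =
     frechet_derivative (outward_normal \<Omega>) (at y within frontier \<Omega>) Y \<bullet> Z"

subsection \<open>Free boundary minimal surfaces and their index\<close>

definition free_boundary_minimal ::
    "(real^3) set \<Rightarrow> 'a topology \<Rightarrow> 'a chart set \<Rightarrow> ('a \<Rightarrow> real^3) \<Rightarrow> ('a \<Rightarrow> real^3) \<Rightarrow> bool" where
  "free_boundary_minimal \<Omega> S A X N \<longleftrightarrow>
     immersion A X \<and> unit_normal A X N \<and>
     (\<forall>p\<in>topspace S. mean_curvature A X N p = 0) \<and>
     X ` topspace S \<subseteq> closure \<Omega> \<and>
     (\<forall>p\<in>topspace S. X p \<in> frontier \<Omega> \<longleftrightarrow> p \<in> surface_boundary A) \<and>
     (\<forall>p\<in>surface_boundary A. N p \<bullet> outward_normal \<Omega> (X p) = 0)"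

interpretation fun_space: vector_space "\<lambda>(c::real) (f::'a \<Rightarrow> real) x. c * f x"
  by unfold_locales (auto simp: fun_eq_iff algebra_simps)

definition test_functions :: "'a topology \<Rightarrow> 'a chart set \<Rightarrow> ('a \<Rightarrow> real) set" where
  "test_functions S A = {f. smooth_map A f \<and> (\<forall>x. x \<notin> topspace S \<longrightarrow> f x = 0) \<and>
     compactin S (S closure_of {x \<in> topspace S. f x \<noteq> 0})}"

definition index_form ::
    "(real^3) set \<Rightarrow> 'a topology \<Rightarrow> 'a chart set \<Rightarrow> ('a \<Rightarrow> real^3) \<Rightarrow> ('a \<Rightarrow> real^3) \<Rightarrow>
     ('a \<Rightarrow> real) \<Rightarrow> real" where
  "index_form \<Omega> S A X N f =
     (LINT p|area_measure S A X. gradient_norm2 A X f p - shape_norm2 A X N p * (f p)\<^sup>2) -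
     (LINT p:surface_boundary A|boundary_measure S A X. second_fundamental_form \<Omega> (X p) (N p) (N p) * (f p)\<^sup>2)"

definition edim :: "('a \<Rightarrow> real) set \<Rightarrow> enat" where
  "edim V = (if \<exists>B. finite B \<and> fun_space.span B = V then enat (fun_space.dim V) else \<infinity>)"

definition morse_index ::
    "(real^3) set \<Rightarrow> 'a topology \<Rightarrow> 'a chart set \<Rightarrow> ('a \<Rightarrow> real^3) \<Rightarrow> ('a \<Rightarrow> real^3) \<Rightarrow> enat" where
  "morse_index \<Omega> S A X N =
     (SUP V \<in> {V. fun_space.subspace V \<and> V \<subseteq> test_functions S A \<and>
                   (\<forall>f\<in>V. f \<noteq> 0 \<longrightarrow> index_form \<Omega> S A X N f < 0)}. edim V)"

subsection \<open>Conformal compactification and multiplicities of ends\<close>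

definition conformal_at :: "'a chart \<Rightarrow> ('a \<Rightarrow> real^3) \<Rightarrow> 'a \<Rightarrow> bool" where
  "conformal_at c X p \<longleftrightarrow> norm (chart_deriv c X p 1) = norm (chart_deriv c X p \<i>) \<and>
     chart_deriv c X p 1 \<bullet> chart_deriv c X p \<i> = 0"

text \<open>\<open>Sc\<close> with holomorphic atlas \<open>R\<close> is the compact surface, \<open>P\<close> the set of punctures; the
  surface \<open>S\<close> is identified with the complement of \<open>P\<close>.\<close>

definition conformal_compactification ::
    "'a topology \<Rightarrow> 'a chart set \<Rightarrow> 'a set \<Rightarrow> 'a topology \<Rightarrow> 'a chart set \<Rightarrow> ('a \<Rightarrow> real^3) \<Rightarrow> bool" where
  "conformal_compactification Sc R P S A X \<longleftrightarrow>
     riemann_surface Sc R \<and> compact_space Sc \<and>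
     finite P \<and> P \<subseteq> topspace Sc - surface_boundary R \<and>
     S = subtopology Sc (topspace Sc - P) \<and>
     surface_boundary A = surface_boundary R \<and>
     (\<forall>(U, \<phi>)\<in>R. (\<forall>c\<in>A. compatible smooth_on (U - P, \<phi>) c) \<and>
                  (\<forall>p\<in>U - P. conformal_at (U - P, \<phi>) X p))"

definition coordinate_disk ::
    "'a topology \<Rightarrow> 'a chart set \<Rightarrow> 'a \<Rightarrow> 'a set \<Rightarrow> ('a \<Rightarrow> complex) \<Rightarrow> bool" where
  "coordinate_disk Sc R p D z \<longleftrightarrow>
     chart_on Sc UNIV (D, z) \<and> (\<forall>c\<in>R. compatible (\<lambda>f W. f holomorphic_on W) (D, z) c) \<and>
     D \<inter> surface_boundary R = {} \<and> p \<in> D \<and> z p = 0 \<and> (\<exists>s>0. z ` D = ball 0 s)"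

text \<open>In a conformal coordinate the factor \<open>\<lambda>\<close> of the metric \<open>\<lambda>\<^sup>2 |dz|\<^sup>2\<close> is the norm of the
  derivative of the position map in the direction \<open>1\<close>.\<close>

definition end_multiplicity ::
    "'a topology \<Rightarrow> 'a chart set \<Rightarrow> ('a \<Rightarrow> real^3) \<Rightarrow> 'a \<Rightarrow> nat \<Rightarrow> bool" where
  "end_multiplicity Sc R X p d \<longleftrightarrow> d \<ge> 1 \<and>
     (\<exists>D z. coordinate_disk Sc R p D z \<and>
        (\<lambda>w. norm (X (inv_into D z w))) \<in> \<Theta>[at 0](\<lambda>w. 1 / norm w ^ d) \<and>
        (\<lambda>w. norm (chart_deriv (D - {p}, z) X (inv_into D z w) 1))
           \<in> \<Theta>[at 0](\<lambda>w. 1 / norm w ^ (d + 1)))"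

subsection \<open>Admissible weights\<close>

definition radial_profile ::
    "'i set \<Rightarrow> ('i \<Rightarrow> 'a set) \<Rightarrow> ('i \<Rightarrow> 'a \<Rightarrow> complex) \<Rightarrow> real \<Rightarrow> ('a \<Rightarrow> real) \<Rightarrow> ('i \<Rightarrow> real \<Rightarrow> real) \<Rightarrow> bool"
  where
  "radial_profile J D z R1 \<rho> h \<longleftrightarrow>
     (\<forall>j\<in>J. h j \<in> borel_measurable (lebesgue_on {0<..R1}) \<and> (\<forall>r\<in>{0<..R1}. h j r > 0)) \<and>
     (\<exists>c C. 0 < c \<and> c \<le> C \<and>
        (\<forall>j\<in>J. \<forall>q\<in>D j. 0 < norm (z j q) \<and> norm (z j q) \<le> R1 \<longrightarrow>
           c * h j (norm (z j q)) \<le> \<rho> q \<and> \<rho> q \<le> C * h j (norm (z j q))))"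

definition integrable_orders :: "real \<Rightarrow> (real \<Rightarrow> real) \<Rightarrow> nat set" where
  "integrable_orders R1 h =
     {m. (\<integral>\<^sup>+ r. ennreal (h r * r / r ^ (2 * m)) \<partial>lebesgue_on {0<..R1}) < \<infinity>}"

definition local_order :: "real \<Rightarrow> (real \<Rightarrow> real) \<Rightarrow> nat" where
  "local_order R1 h = Max (integrable_orders R1 h)"

text \<open>The last clause says that the maximum defining \<open>local_order\<close> exists. Different radial
  profiles of the same weight are comparable, hence have the same integrable orders.\<close>

definition admissible ::
    "'a topology \<Rightarrow> 'a topology \<Rightarrow> 'i set \<Rightarrow> ('i \<Rightarrow> 'a set) \<Rightarrow> ('i \<Rightarrow> 'a \<Rightarrow> complex) \<Rightarrow> real \<Rightarrow>
     ('a \<Rightarrow> real) \<Rightarrow> bool" where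
  "admissible Sc S J D z R1 \<rho> \<longleftrightarrow>
     continuous_map S euclideanreal \<rho> \<and> (\<forall>q\<in>topspace S. \<rho> q > 0) \<and>
     bounded (\<rho> ` topspace S) \<and>
     (\<exists>\<epsilon>>0. \<forall>q \<in> topspace Sc - (\<Union>j\<in>J. D j). \<epsilon> \<le> \<rho> q) \<and>
     (\<exists>h. radial_profile J D z R1 \<rho> h \<and>
          (\<forall>j\<in>J. integrable_orders R1 (h j) \<noteq> {} \<and> finite (integrable_orders R1 (h j))))"

definition log_weight :: "real^3 \<Rightarrow> real" where
  "log_weight x = 1 / ((1 + (norm x)\<^sup>2) * (ln (2 + norm x))\<^sup>2)"

end

theory Submission
  imports Defs
begin

text \<open>
  Near a puncture \<open>|X|\<close> is comparable to \<open>|z|\<^sup>-\<^sup>d\<close>, in the given coordinate as well as in the one that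
  witnesses the multiplicity, because holomorphic changes of coordinates distort \<open>|z|\<close> by bounded
  factors. On the rest of the disk \<open>X\<close> is bounded by compactness. The weight depends only on \<open>|X|\<close>
  and changes by a bounded factor when \<open>1 + |X|\<close> does, so the value of the weight at \<open>|X| = r\<^sup>-\<^sup>d\<close>
  is a radial profile. Near \<open>0\<close> it behaves like \<open>r\<^sup>2\<^sup>d / log\<^sup>2 r\<close>; multiplied by \<open>r\<^sup>1\<^sup>-\<^sup>2\<^sup>m\<close> it
  is integrable for \<open>m = d + 1\<close> thanks to the logarithm, and no longer for \<open>m = d + 2\<close>. Any other radial
  profile is comparable to this one.
\<close>

section \<open>The weight as a function of the distance to the origin\<close>

definition log_profile :: "real \<Rightarrow> real" where
  "log_profile t = 1 / ((1 + t\<^sup>2) * (ln (2 + t))\<^sup>2)"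

lemma log_weight_eq: "log_weight x = log_profile (norm x)"
  by (simp add: log_weight_def log_profile_def)

lemma ln_2_add_ge: "ln 2 \<le> ln (2 + t)" if "0 \<le> t" for t :: real
  using that by simp

lemma log_profile_pos: "0 < log_profile t" if "0 \<le> t"
proof -
  have "0 < ln (2 + t)" using that by simp
  moreover have "0 < 1 + t\<^sup>2" by (simp add: add_pos_nonneg)
  ultimately show ?thesis by (simp add: log_profile_def)
qed

lemma continuous_on_log_profile: "continuous_on {0..} log_profile"
proof -
  have "(1 + t\<^sup>2) * (ln (2 + t))\<^sup>2 \<noteq> 0" if "0 \<le> t" for t :: real
    using log_profile_pos[OF that] by (auto simp: log_profile_def)
  then show ?thesis unfolding log_profile_def
    by (intro continuous_intros) auto
qed

text \<open>Replacing \<open>t\<close> by \<open>s\<close> multiplies the quadratic factor by at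
  most \<open>2 * K^2\<close>, since \<open>(1 + t)^2 <= 2 * (1 + t^2)\<close>. In the logarithm the
  factor \<open>K\<close> becomes the summand \<open>ln K\<close>, which turns into a multiplicative
  factor because \<open>ln (2 + t)\<close> is at least \<open>ln 2\<close>. Exchanging
  \<open>s\<close> and \<open>t\<close> gives the opposite estimate.\<close>

lemma log_profile_comparable:
  assumes "0 \<le> s" "0 \<le> t" "1 \<le> K" "1 + s \<le> K * (1 + t)"
  shows "log_profile t \<le> 2 * K\<^sup>2 * (1 + ln K / ln 2)\<^sup>2 * log_profile s"
proof -
  let ?c = "1 + ln K / ln 2"
  have "1 + s\<^sup>2 \<le> (1 + s)\<^sup>2" using assms by (simp add: power2_sum)
  also have "\<dots> \<le> (K * (1 + t))\<^sup>2" using assms by (intro power_mono) auto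
  also have "\<dots> = K\<^sup>2 * (1 + t)\<^sup>2" by (simp add: power_mult_distrib)
  also have "\<dots> \<le> K\<^sup>2 * (2 * (1 + t\<^sup>2))"
    using sum_squares_bound[of 1 t] by (intro mult_left_mono) (auto simp: power2_sum)
  finally have 1: "1 + s\<^sup>2 \<le> 2 * K\<^sup>2 * (1 + t\<^sup>2)" by (simp add: algebra_simps)
  have "2 + s \<le> K * (2 + t)" using assms by (simp add: algebra_simps)
  then have "ln (2 + s) \<le> ln (K * (2 + t))" using assms by (subst ln_le_cancel_iff) auto
  also have "\<dots> = ln K + ln (2 + t)" using assms by (simp add: ln_mult)
  also have "\<dots> \<le> ?c * ln (2 + t)"
    using mult_left_mono[OF ln_2_add_ge[OF assms(2)], of "ln K / ln 2"] assms
    by (simp add: algebra_simps)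
  finally have "(ln (2 + s))\<^sup>2 \<le> (?c * ln (2 + t))\<^sup>2" using assms by (intro power_mono) auto
  then have "(1 + s\<^sup>2) * (ln (2 + s))\<^sup>2 \<le> (2 * K\<^sup>2 * (1 + t\<^sup>2)) * (?c * ln (2 + t))\<^sup>2"
    using 1 by (intro mult_mono) auto
  also have "\<dots> = 2 * K\<^sup>2 * ?c\<^sup>2 * ((1 + t\<^sup>2) * (ln (2 + t))\<^sup>2)"
    by (simp add: power_mult_distrib)
  finally have "1 / log_profile s \<le> 2 * K\<^sup>2 * ?c\<^sup>2 * (1 / log_profile t)"
    by (simp add: log_profile_def)
  then show ?thesis
    using log_profile_pos[OF assms(1)] log_profile_pos[OF assms(2)] by (simp add: field_simps)
qed

section \<open>Radial integrals near a puncture\<close>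

lemma nn_integral_lebesgue_on_eq:
  fixes f :: "real \<Rightarrow> real"
  assumes "f \<in> borel_measurable borel" "a < b"
  shows "(\<integral>\<^sup>+r. ennreal (f r) \<partial>lebesgue_on {a<..b}) = (\<integral>\<^sup>+r. ennreal (f r) * indicator {a<..b} r \<partial>lborel)"
  using assms by (simp add: nn_integral_restrict_space nn_integral_completion)

text \<open>This is the borderline case \<open>m = d + 1\<close>: the powers of \<open>r\<close>
  leave \<open>1 / r\<close>, and the squared logarithm alone makes the integral converge, because
  the reciprocal of the logarithm is a bounded primitive up to bounded factors.\<close>

lemma nn_integral_log_profile_finite:
  assumes "0 < d" "0 < R"
  shows "(\<integral>\<^sup>+r. ennreal (1 / (r * (ln (2 + 1 / r ^ d))\<^sup>2)) \<partial>lebesgue_on {0<..R}) < \<infinity>"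
proof -
  let ?L = "\<lambda>r::real. ln (2 + 1 / r ^ d)"
  \<comment> \<open>Up to the bounded factor \<open>d / (2 r\<^sup>d + 1)\<close>, the integrand below is the derivative of \<open>1 / L\<close>.\<close>
  define F where "F r = (if r = 0 then 0 else 1 / ?L r)" for r :: real
  define f where "f r = real d / (r * (2 * r ^ d + 1) * (?L r)\<^sup>2)" for r :: real
  have L0: "0 < ?L r" if "0 < r" for r :: real
    using that by (intro ln_gt_zero) (simp add: add_pos_pos)
  have der: "(F has_real_derivative f r) (at r)" if "0 < r" for r
  proof -
    have ev: "\<forall>\<^sub>F x in nhds r. F x = 1 / ?L x"
      by (rule eventually_mono[OF eventually_nhds_in_open[of "{0<..}" r]]) (use that in \<open>auto simp: F_def\<close>)
    have "((\<lambda>x. 1 / ?L x) has_real_derivative f r) (at r)"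
    proof -
      let ?P = "r ^ (d - 1)"
      let ?E = "- (real d * ?P) / (r ^ d)\<^sup>2 / (2 + 1 / r ^ d)"
      have pos: "2 + 1 / r ^ d > 0" using that by (simp add: add_pos_pos)
      have L: "?L r \<noteq> 0" using L0[OF that] by linarith
      have "((\<lambda>x. 1 / x ^ d) has_real_derivative - (real d * ?P) / (r ^ d)\<^sup>2) (at r)"
        using that by (auto intro!: derivative_eq_intros simp: power2_eq_square)
      then have *: "((\<lambda>x. 2 + 1 / x ^ d) has_real_derivative - (real d * ?P) / (r ^ d)\<^sup>2) (at r)"
        using DERIV_add[OF DERIV_const] by fastforce
      have **: "(?L has_real_derivative ?E) (at r)"
        using DERIV_chain2[where f = ln, OF DERIV_ln_divide[OF pos] *] by (simp add: mult.commute)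
      have inv: "((\<lambda>x. inverse (?L x)) has_real_derivative - (?E * inverse (?L r ^ Suc (Suc 0)))) (at r)"
        by (rule DERIV_inverse_fun[OF ** L])
      \<comment> \<open>The chain rule leaves nested fractions in \<open>r ^ d\<close>; splitting
        off one factor \<open>r\<close> from \<open>r ^ d\<close> cancels \<open>r ^ (d - 1)\<close>
        and yields the denominator of \<open>f\<close>.\<close>
      have E: "?E = - (real d / (r * (2 * r ^ d + 1)))"
      proof -
        have P: "r ^ d = r * ?P" using assms by (simp add: power_eq_if)
        have "2 + 1 / r ^ d = (2 * r ^ d + 1) / r ^ d" using that by (simp add: field_simps)
        then have "?E = - (real d * ?P / (r ^ d * (2 * r ^ d + 1)))"
          using that by (simp add: power2_eq_square)
        also have "\<dots> = - (real d / (r * (2 * r ^ d + 1)))" using that by (subst P) simp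
        finally show ?thesis .
      qed
      show ?thesis
        using inv unfolding E by (simp add: f_def inverse_eq_divide power2_eq_square mult_ac)
    qed
    then show ?thesis using DERIV_cong_ev[OF refl ev refl] by blast
  qed
  \<comment> \<open>The logarithm tends to infinity at \<open>0\<close>, so \<open>F 0 = 0\<close>
    is the right limit. The bare formula would give \<open>1 / ln 2\<close> there, as
    \<open>1 / 0 = 0\<close>. Continuity on the closed interval then lets the fundamental theorem
    work with derivatives in the interior only.\<close>
  have lim: "(F \<longlongrightarrow> 0) (at_right 0)"
  proof -
    have "((\<lambda>r. 1 / ?L r) \<longlongrightarrow> 0) (at_right 0)"
    proof -
      have "filterlim (\<lambda>r::real. r ^ d) (at_right 0) (at_right 0)"
        unfolding filterlim_at using assms
        by (auto intro!: tendsto_eq_intros simp: eventually_at_right_less eventually_at_filter)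
      then have "filterlim (\<lambda>r::real. 2 + inverse (r ^ d)) at_top (at_right 0)"
        by (intro filterlim_tendsto_add_at_top[OF tendsto_const]
              filterlim_compose[OF filterlim_inverse_at_top_right])
      then have "filterlim ?L at_top (at_right 0)"
        by (intro filterlim_compose[OF ln_at_top]) (simp add: inverse_eq_divide)
      then show ?thesis
        by (intro tendsto_divide_0[OF tendsto_const] filterlim_at_top_imp_at_infinity)
    qed
    then show ?thesis
      by (rule Lim_transform_eventually)
        (auto simp: F_def eventually_at_right_less eventually_at_filter)
  qed
  have cont: "continuous_on {0..R} F"
    unfolding continuous_on_eq_continuous_within
  proof
    fix x assume x: "x \<in> {0..R}"
    show "continuous (at x within {0..R}) F"
    proof (cases "x = 0")
      case True
      have "at 0 within {0..R} \<le> at_right (0::real)"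
        by (simp add: at_within_Icc_at_right assms)
      then show ?thesis using tendsto_mono[OF _ lim] True by (simp add: continuous_within F_def)
    next
      case False
      then show ?thesis using DERIV_isCont[OF der, of x] x
        by (auto intro: continuous_at_imp_continuous_within)
    qed
  qed
  have f0: "0 \<le> f r" if "0 \<le> r" for r using that by (simp add: f_def)
  have "(f has_integral (F R - F 0)) {0..R}"
    using assms der
    by (intro fundamental_theorem_of_calculus_interior cont)
       (auto simp: has_real_derivative_iff_has_vector_derivative)
  then have fin: "(\<integral>\<^sup>+r. ennreal (f r) * indicator {0..R} r \<partial>lborel) = ennreal (F R - F 0)"
    by (intro nn_integral_has_integral_lebesgue') (auto intro: f0)
  have fm: "f \<in> borel_measurable borel" unfolding f_def by measurable
  \<comment> \<open>The factor \<open>d / (2 * r ^ d + 1)\<close> is smallest at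
    \<open>r = R\<close>; \<open>M\<close> is the reciprocal of that value.\<close>
  define M where "M = (2 * R ^ d + 1) / d"
  have M: "0 \<le> M" using assms by (simp add: M_def)
  have le: "1 / (r * (?L r)\<^sup>2) \<le> M * f r" if r: "r \<in> {0<..R}" for r
  proof -
    have "r ^ d \<le> R ^ d" using r by (intro power_mono) auto
    have "0 \<le> r ^ d" using r by simp
    then have "1 \<le> (2 * R ^ d + 1) / (2 * r ^ d + 1)" using \<open>r ^ d \<le> R ^ d\<close> by simp
    then have "1 / (r * (?L r)\<^sup>2) * 1 \<le> 1 / (r * (?L r)\<^sup>2) * ((2 * R ^ d + 1) / (2 * r ^ d + 1))"
      using r by (intro mult_left_mono) auto
    also have "\<dots> = M * f r" using assms by (simp add: M_def f_def)
    finally show ?thesis by simp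
  qed
  have "(\<integral>\<^sup>+r. ennreal (1 / (r * (?L r)\<^sup>2)) \<partial>lebesgue_on {0<..R})
      \<le> (\<integral>\<^sup>+r. ennreal (M * f r) \<partial>lebesgue_on {0<..R})"
    by (intro nn_integral_mono ennreal_leI le) simp
  also have "\<dots> = (\<integral>\<^sup>+r. ennreal (M * f r) * indicator {0<..R} r \<partial>lborel)"
    using assms fm by (intro nn_integral_lebesgue_on_eq) auto
  \<comment> \<open>The interval is closed up at \<open>0\<close> to reach the form in which
    \<open>fin\<close> evaluates the integral.\<close>
  also have "\<dots> \<le> (\<integral>\<^sup>+r. ennreal M * (ennreal (f r) * indicator {0..R} r) \<partial>lborel)"
    by (intro nn_integral_mono) (auto simp: indicator_def ennreal_mult M f0)
  also have "\<dots> = ennreal M * ennreal (F R - F 0)"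
    using fm by (subst nn_integral_cmult) (auto simp: fin)
  also have "\<dots> < \<infinity>" by (simp add: ennreal_mult_less_top)
  finally show ?thesis .
qed

text \<open>The primitive \<open>c * ln r\<close> is unbounded below at \<open>0\<close>, so the
  integral exceeds every real bound.\<close>

lemma nn_integral_inverse_infinite:
  assumes "0 < R" "0 < c"
  shows "(\<integral>\<^sup>+r. ennreal (c / r) \<partial>lebesgue_on {0<..R}) = \<infinity>"
proof -
  have lower: "ennreal b \<le> (\<integral>\<^sup>+r. ennreal (c / r) \<partial>lebesgue_on {0<..R})" if "0 \<le> b" for b
  proof -
    \<comment> \<open>Solves \<open>c * (ln R - ln e) = b\<close>: the part of the integral over
      \<open>{e..R}\<close> is exactly \<open>b\<close>.\<close>
    define e where "e = R * exp (- b / c)"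
    have e: "0 < e" "e \<le> R" using assms that by (auto simp: e_def mult_le_cancel_left1)
    have "ennreal b = ennreal (c * ln R - c * ln e)"
      using assms by (simp add: e_def ln_mult algebra_simps)
    also have "\<dots> = (\<integral>\<^sup>+r. ennreal (c / r) * indicator {e..R} r \<partial>lborel)"
      using e assms
      by (intro nn_integral_FTC_Icc[symmetric])
         (auto intro!: derivative_eq_intros simp: has_real_derivative_iff_has_vector_derivative[symmetric])
    also have "\<dots> \<le> (\<integral>\<^sup>+r. ennreal (c / r) * indicator {0<..R} r \<partial>lborel)"
      using e by (intro nn_integral_mono) (auto simp: indicator_def)
    also have "\<dots> = (\<integral>\<^sup>+r. ennreal (c / r) \<partial>lebesgue_on {0<..R})"
      using assms by (intro nn_integral_lebesgue_on_eq[symmetric]) auto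
    finally show ?thesis .
  qed
  show ?thesis
  proof (rule ccontr)
    assume "\<not> ?thesis"
    then obtain b where b: "0 \<le> b" "(\<integral>\<^sup>+r. ennreal (c / r) \<partial>lebesgue_on {0<..R}) = ennreal b"
      by (cases "\<integral>\<^sup>+r. ennreal (c / r) \<partial>lebesgue_on {0<..R}") auto
    show False using lower[of "b + 1"] b by simp
  qed
qed

text \<open>For \<open>m <= d + 1\<close> the integrand is dominated by a multiple of the borderline
  integrand; for \<open>m >= d + 2\<close> it dominates a multiple of \<open>1 / r\<close>. Allowing
  every \<open>h\<close> between two multiples of the standard profile covers all radial profiles of
  the weight at once.\<close>

lemma integrable_orders_log_profile:
  assumes "0 < d" "0 < R" "0 < c"
    and h: "\<And>r. r \<in> {0<..R} \<Longrightarrow> c * log_profile (1 / r ^ d) \<le> h r \<and> h r \<le> C * log_profile (1 / r ^ d)"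
  shows "integrable_orders R h = {..d + 1}"
proof -
  let ?L = "\<lambda>r::real. ln (2 + 1 / r ^ d)"
  have prof: "log_profile (1 / r ^ d) = r ^ (2 * d) / ((r ^ (2 * d) + 1) * (?L r)\<^sup>2)" if "0 < r" for r
    using that by (simp add: log_profile_def field_simps power_mult)
  have L0: "0 < ?L r" if "0 < r" for r :: real
    using that by (intro ln_gt_zero) (simp add: add_pos_pos)
  \<comment> \<open>The sign of \<open>C\<close> follows from the two bounds at the single radius
    \<open>R\<close>.\<close>
  have C: "0 \<le> C"
  proof -
    have "0 < c * log_profile (1 / R ^ d)" using assms by (simp add: log_profile_pos)
    also have "\<dots> \<le> C * log_profile (1 / R ^ d)" using h[of R] assms by force
    finally show ?thesis using log_profile_pos[of "1 / R ^ d"] assms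
      by (simp add: zero_less_mult_iff)
  qed
  have small: "m \<in> integrable_orders R h" if m: "m \<le> d + 1" for m
  proof -
    \<comment> \<open>For \<open>m\<close> below \<open>d + 1\<close> a surplus power of
      \<open>r\<close> remains; it is bounded by its value at \<open>R\<close>.\<close>
    define M where "M = C * R ^ (2 * (d + 1 - m))"
    have M: "0 \<le> M" using C assms by (simp add: M_def)
    have le: "h r * r / r ^ (2 * m) \<le> M * (1 / (r * (?L r)\<^sup>2))" if r: "r \<in> {0<..R}" for r
    proof -
      have r0: "0 < r" using r by simp
      have pw: "r ^ (2 * d) * r ^ 2 = r ^ (2 * m) * r ^ (2 * (d + 1 - m))"
        using m by (simp flip: power_add) (simp add: algebra_simps)
      have "log_profile (1 / r ^ d) \<le> r ^ (2 * d) / (1 * (?L r)\<^sup>2)"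
        unfolding prof[OF r0] using r0
        by (intro divide_left_mono mult_right_mono mult_pos_pos zero_less_power L0)
           (auto simp: add_pos_pos)
      then have "C * log_profile (1 / r ^ d) \<le> C * (r ^ (2 * d) / (?L r)\<^sup>2)"
        using C by (intro mult_left_mono) auto
      then have "h r \<le> C * (r ^ (2 * d) / (?L r)\<^sup>2)" using h[OF r] by linarith
      then have "h r * r / r ^ (2 * m) \<le> C * (r ^ (2 * d) / (?L r)\<^sup>2) * r / r ^ (2 * m)"
        using r0 by (intro divide_right_mono mult_right_mono) auto
      also have "\<dots> = C * (r ^ (2 * d) * r ^ 2) / (r ^ (2 * m) * r * (?L r)\<^sup>2)"
        by (simp add: power2_eq_square mult_ac)
      also have "\<dots> = C * r ^ (2 * (d + 1 - m)) * (1 / (r * (?L r)\<^sup>2))"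
        unfolding pw using r0 by simp
      also have "\<dots> \<le> M * (1 / (r * (?L r)\<^sup>2))"
        unfolding M_def using r C by (intro mult_right_mono mult_left_mono power_mono) auto
      finally show ?thesis .
    qed
    have "(\<integral>\<^sup>+r. ennreal (h r * r / r ^ (2 * m)) \<partial>lebesgue_on {0<..R})
        \<le> (\<integral>\<^sup>+r. ennreal M * ennreal (1 / (r * (?L r)\<^sup>2)) \<partial>lebesgue_on {0<..R})"
      using le M by (intro nn_integral_mono) (auto simp flip: ennreal_mult intro!: ennreal_leI)
    also have "\<dots> = ennreal M * (\<integral>\<^sup>+r. ennreal (1 / (r * (?L r)\<^sup>2)) \<partial>lebesgue_on {0<..R})"
    proof (rule nn_integral_cmult)
      have "(\<lambda>r. ennreal (1 / (r * (?L r)\<^sup>2))) \<in> borel_measurable borel" by measurable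
      then show "(\<lambda>r. ennreal (1 / (r * (?L r)\<^sup>2))) \<in> borel_measurable (lebesgue_on {0<..R})"
        by (intro measurable_restrict_space1 measurable_completion) simp
    qed
    also have "\<dots> < \<infinity>"
      using nn_integral_log_profile_finite[OF assms(1,2)] by (simp add: ennreal_mult_less_top)
    finally show ?thesis by (simp add: integrable_orders_def)
  qed
  have large: "m \<notin> integrable_orders R h" if m: "d + 2 \<le> m" for m
  proof -
    \<comment> \<open>Chosen so that the logarithm is at most \<open>B / r\<close>, from
      \<open>ln (1 / r) <= 1 / r\<close> and \<open>1 <= R / r\<close>. This crude bound suffices:
      squared, it costs two powers of \<open>r\<close>, which for \<open>m = d + 2\<close> leaves
      exactly a multiple of \<open>1 / r\<close>.\<close>
    define B where "B = R * ln (2 * R ^ d + 1) + d"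
    have "0 < ln (2 * R ^ d + 1)" using assms by (intro ln_gt_zero) simp
    then have B: "0 < B" using assms by (simp add: B_def add_pos_pos)
    \<comment> \<open>The remaining factors in the denominator, \<open>r ^ (2 * d) + 1\<close> and
      the surplus power of \<open>r\<close> for larger \<open>m\<close>, are replaced by their
      values at \<open>R\<close>.\<close>
    define M where "M = c / ((R ^ (2 * d) + 1) * B\<^sup>2 * R ^ (2 * (m - (d + 2))))"
    have M: "0 < M" using assms B by (simp add: M_def add_pos_pos)
    have le: "M / r \<le> h r * r / r ^ (2 * m)" if r: "r \<in> {0<..R}" for r
    proof -
      have r0: "0 < r" using r by simp
      have rR: "r ^ k \<le> R ^ k" for k using r by (intro power_mono) auto
      have pw: "r ^ (2 * m) = r ^ (2 * d) * r ^ 4 * r ^ (2 * (m - (d + 2)))"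
        unfolding power_add[symmetric] using m by (intro arg_cong[of _ _ "power r"]) linarith
      have "2 + 1 / r ^ d = (2 * r ^ d + 1) * (1 / r) ^ d" using r0 by (simp add: field_simps)
      moreover have "2 * r ^ d + 1 > 0" "1 / r > 0" using r0 by (simp_all add: add_pos_pos)
      ultimately have "?L r = ln (2 * r ^ d + 1) + d * ln (1 / r)"
        by (metis ln_mult_pos ln_realpow zero_less_power)
      also have "\<dots> \<le> ln (2 * R ^ d + 1) + d * (1 / r)"
      proof (intro add_mono mult_left_mono)
        show "ln (2 * r ^ d + 1) \<le> ln (2 * R ^ d + 1)"
          using rR[of d] \<open>2 * r ^ d + 1 > 0\<close> by (subst ln_le_cancel_iff) auto
        show "ln (1 / r) \<le> 1 / r" using r0 ln_le_minus_one[of "1 / r"] by simp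
      qed simp
      also have "\<dots> \<le> ln (2 * R ^ d + 1) * (R / r) + d * (1 / r)"
        using r \<open>0 < ln (2 * R ^ d + 1)\<close> by (simp add: field_simps)
      also have "\<dots> = B / r" by (simp add: B_def add_divide_distrib)
      finally have "(?L r)\<^sup>2 \<le> (B / r)\<^sup>2" using L0[OF r0] by (intro power_mono) auto
      then have "r ^ (2 * d) / ((R ^ (2 * d) + 1) * (B / r)\<^sup>2) \<le> log_profile (1 / r ^ d)"
        unfolding prof[OF r0] using r0 rR[of "2 * d"] B assms
        by (intro divide_left_mono mult_mono mult_pos_pos add_mono zero_less_power L0)
           (auto simp: add_pos_pos)
      then have "c * (r ^ (2 * d) / ((R ^ (2 * d) + 1) * (B / r)\<^sup>2)) \<le> c * log_profile (1 / r ^ d)"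
        using assms by (intro mult_left_mono) auto
      then have hr: "c * (r ^ (2 * d) / ((R ^ (2 * d) + 1) * (B / r)\<^sup>2)) \<le> h r"
        using h[OF r] by linarith
      have "M / r \<le> c / ((R ^ (2 * d) + 1) * B\<^sup>2 * r ^ (2 * (m - (d + 2)))) / r"
        unfolding M_def using assms B r0 rR
        by (intro divide_right_mono divide_left_mono mult_left_mono mult_pos_pos) (auto simp: add_pos_pos)
      also have "\<dots> = c * (r ^ (2 * d) / ((R ^ (2 * d) + 1) * (B / r)\<^sup>2)) * r / r ^ (2 * m)"
        unfolding pw using r0 B by (simp add: power_divide power2_eq_square power4_eq_xxxx)
      also have "\<dots> \<le> h r * r / r ^ (2 * m)"
        using hr r0 by (intro divide_right_mono mult_right_mono) auto
      finally show ?thesis .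
    qed
    have "\<infinity> = (\<integral>\<^sup>+r. ennreal (M / r) \<partial>lebesgue_on {0<..R})"
      using nn_integral_inverse_infinite[OF assms(2) M] by simp
    also have "\<dots> \<le> (\<integral>\<^sup>+r. ennreal (h r * r / r ^ (2 * m)) \<partial>lebesgue_on {0<..R})"
      by (intro nn_integral_mono ennreal_leI le) simp
    finally show ?thesis by (simp add: integrable_orders_def)
  qed
  show ?thesis
  proof (rule set_eqI)
    fix m show "m \<in> integrable_orders R h \<longleftrightarrow> m \<in> {..d + 1}"
      using small[of m] large[of m] by (cases "m \<le> d + 1") simp_all
  qed
qed

section \<open>Charts and holomorphic changes of coordinates\<close>

lemma chart_onD:
  assumes "chart_on S M (U, \<phi>)"
  shows "openin S U" "openin (top_of_set M) (\<phi> ` U)"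
    and "homeomorphic_map (subtopology S U) (top_of_set (\<phi> ` U)) \<phi>"
    and "topspace (subtopology S U) = U" and "inj_on \<phi> U"
proof -
  show *: "openin S U" "openin (top_of_set M) (\<phi> ` U)"
    and hom: "homeomorphic_map (subtopology S U) (top_of_set (\<phi> ` U)) \<phi>"
    using assms by (auto simp: chart_on_def)
  from *(1) show US: "topspace (subtopology S U) = U" by (auto dest: openin_subset)
  show "inj_on \<phi> U" using homeomorphic_imp_injective_map[OF hom] unfolding US .
qed

text \<open>Each local extension is continuous on an open set, and restricting to an open
  neighbourhood does not change limits within the chart image. This gives continuity in every chart,
  and the open chart domains are pasted together.\<close>

lemma smooth_map_imp_continuous_map:
  assumes "smooth_surface S A" "smooth_map A f"
  shows "continuous_map S euclidean f"
proof (rule pasting_lemma[where T = fst and I = A and f = "\<lambda>_. f"])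
  fix c assume c: "c \<in> A"
  obtain U \<phi> where c_eq: "c = (U, \<phi>)" by fastforce
  have ch: "chart_on S half_plane (U, \<phi>)"
    using assms(1) c by (auto simp: surface_with_boundary_def c_eq)
  note hom = chart_onD(3)[OF ch] and US = chart_onD(4)[OF ch] and inj = chart_onD(5)[OF ch]
  show "openin S (fst c)" using chart_onD(1)[OF ch] by (simp add: c_eq)
  have ext: "locally_extends smooth_on (f \<circ> inv_into U \<phi>) (\<phi> ` U)"
    using assms(2) c by (auto simp: smooth_map_def c_eq)
  have "continuous_on (\<phi> ` U) (f \<circ> inv_into U \<phi>)"
    unfolding continuous_on_eq_continuous_within
  proof
    fix w assume w: "w \<in> \<phi> ` U"
    then obtain W g where W: "open W" "w \<in> W" "smooth_on g W"
      and eq: "\<forall>v\<in>W \<inter> \<phi> ` U. g v = (f \<circ> inv_into U \<phi>) v"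
      using ext unfolding locally_extends_def by blast
    have "continuous_on W g" using W(3) by (metis Ck.simps(1) smooth_on_def)
    then have "continuous_on (W \<inter> \<phi> ` U) (f \<circ> inv_into U \<phi>)"
      using eq by (metis continuous_on_cong continuous_on_subset inf_le1)
    then have "continuous (at w within (W \<inter> \<phi> ` U)) (f \<circ> inv_into U \<phi>)"
      using W(2) w by (metis IntI continuous_on_eq_continuous_within)
    moreover have "at w within (W \<inter> \<phi> ` U) = at w within (\<phi> ` U)"
      using W by (intro at_within_nhd[of w W]) auto
    ultimately show "continuous (at w within \<phi> ` U) (f \<circ> inv_into U \<phi>)"
      by (simp add: continuous_within)
  qed
  then have "continuous_map (top_of_set (\<phi> ` U)) euclidean (f \<circ> inv_into U \<phi>)" by simp
  then have "continuous_map (subtopology S U) euclidean ((f \<circ> inv_into U \<phi>) \<circ> \<phi>)"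
    using homeomorphic_imp_continuous_map[OF hom] by (rule continuous_map_compose[rotated])
  then have "continuous_map (subtopology S U) euclidean f"
    by (rule continuous_map_eq) (auto simp: US inj)
  then show "continuous_map (subtopology S (fst c)) euclidean f" by (simp add: c_eq)
next
  fix x assume "x \<in> topspace S"
  then show "\<exists>j. j \<in> A \<and> x \<in> fst j \<and> f x = f x"
    using assms(1) by (auto simp: surface_with_boundary_def)
qed auto

text \<open>The difference quotient of the holomorphic extension at the image of \<open>p\<close>
  converges to the derivative, so nearby it is bounded by the modulus of the derivative plus
  \<open>1\<close>. Only differences from the value at \<open>p\<close> are controlled, which is
  what coordinates vanishing at \<open>p\<close> require.\<close>

lemma holomorphic_transition_Lipschitz_at:
  assumes ch: "chart_on T M (U, \<phi>)" and V: "openin T V"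
    and tr: "transition_ok (\<lambda>f W. f holomorphic_on W) (U, \<phi>) (V, \<psi>)"
    and p: "p \<in> U \<inter> V"
  obtains W K where "openin T W" "p \<in> W" "W \<subseteq> U \<inter> V" "0 < K"
    "\<And>q. q \<in> W \<Longrightarrow> norm (\<psi> q - \<psi> p) \<le> K * norm (\<phi> q - \<phi> p)"
proof -
  note U = chart_onD(1)[OF ch] and hom = chart_onD(3)[OF ch]
    and US = chart_onD(4)[OF ch] and inj = chart_onD(5)[OF ch]
  have "locally_extends (\<lambda>f W. f holomorphic_on W) (\<psi> \<circ> inv_into U \<phi>) (\<phi> ` (U \<inter> V))"
    using tr by (simp add: transition_ok_def)
  from bspec[OF this[unfolded locally_extends_def] imageI[OF p]]
  obtain G g where G: "open G" "\<phi> p \<in> G" "g holomorphic_on G"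
    and eq: "\<forall>v\<in>G \<inter> \<phi> ` (U \<inter> V). g v = (\<psi> \<circ> inv_into U \<phi>) v"
    by (elim exE conjE)
  have g: "g (\<phi> q) = \<psi> q" if "q \<in> U \<inter> V" "\<phi> q \<in> G" for q
    using bspec[OF eq, of "\<phi> q"] that inj by auto
  obtain D where "(g has_field_derivative D) (at (\<phi> p))"
    using G holomorphic_on_imp_differentiable_at field_differentiable_def by blast
  then have "((\<lambda>y. (g y - g (\<phi> p)) / (y - \<phi> p)) \<longlongrightarrow> D) (at (\<phi> p))"
    by (simp add: has_field_derivative_iff)
  then have "((\<lambda>y. norm ((g y - g (\<phi> p)) / (y - \<phi> p))) \<longlongrightarrow> norm D) (at (\<phi> p))"
    by (rule tendsto_norm)
  then have "\<forall>\<^sub>F y in at (\<phi> p). norm ((g y - g (\<phi> p)) / (y - \<phi> p)) < norm D + 1"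
    by (rule order_tendstoD) simp
  then obtain e where e: "0 < e"
    "\<And>y. y \<noteq> \<phi> p \<Longrightarrow> dist y (\<phi> p) < e \<Longrightarrow> norm ((g y - g (\<phi> p)) / (y - \<phi> p)) < norm D + 1"
    unfolding eventually_at by blast
  \<comment> \<open>The intersection with \<open>V\<close> is essential: only on
    \<open>U \<inter> V\<close> does \<open>g\<close> represent the transition map.\<close>
  define W where "W = {q \<in> topspace (subtopology T U). \<phi> q \<in> \<phi> ` U \<inter> (G \<inter> ball (\<phi> p) e)} \<inter> V"
  have "openin (subtopology T U) {q \<in> topspace (subtopology T U). \<phi> q \<in> \<phi> ` U \<inter> (G \<inter> ball (\<phi> p) e)}"
    using homeomorphic_imp_continuous_map[OF hom]
    by (rule openin_continuous_map_preimage) (use G in \<open>auto intro: openin_open_Int\<close>)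
  then have "openin T {q \<in> topspace (subtopology T U). \<phi> q \<in> \<phi> ` U \<inter> (G \<inter> ball (\<phi> p) e)}"
    using U by (rule openin_trans_full)
  then have W: "openin T W" unfolding W_def using V by (rule openin_Int)
  show ?thesis
  proof
    show "openin T W" by (fact W)
    show "p \<in> W" "W \<subseteq> U \<inter> V" using p G e US by (auto simp: W_def)
    show "0 < norm D + 1" by (simp add: add_nonneg_pos)
    fix q assume "q \<in> W"
    then have q: "q \<in> U \<inter> V" "\<phi> q \<in> G" "dist (\<phi> q) (\<phi> p) < e"
      using US by (auto simp: W_def dist_commute)
    show "norm (\<psi> q - \<psi> p) \<le> (norm D + 1) * norm (\<phi> q - \<phi> p)"
    proof (cases "\<phi> q = \<phi> p")
      case True
      then have "q = p" using inj p q by (auto dest: inj_onD)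
      then show ?thesis by simp
    next
      case False
      then have "norm (g (\<phi> q) - g (\<phi> p)) / norm (\<phi> q - \<phi> p) < norm D + 1"
        using e(2) q by (simp add: norm_divide)
      then show ?thesis using False g q p G by (simp add: field_simps)
    qed
  qed
qed

text \<open>By definition a coordinate disk is compatible with the charts of \<open>R\<close>, not
  directly with another disk. The comparison therefore passes through a chart of \<open>R\<close>
  around \<open>p\<close>, and the two Lipschitz constants multiply.\<close>

lemma coordinate_disks_comparable:
  assumes R: "riemann_surface Sc R"
    and D: "coordinate_disk Sc R p D z" and D': "coordinate_disk Sc R p D' z'"
  obtains W K where "openin Sc W" "p \<in> W" "W \<subseteq> D \<inter> D'" "0 < K"
    "\<And>q. q \<in> W \<Longrightarrow> norm (z' q) \<le> K * norm (z q)"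
proof -
  have ch: "chart_on Sc UNIV (D, z)" "chart_on Sc UNIV (D', z')" and p: "p \<in> D" "p \<in> D'"
    and z0: "z p = 0" "z' p = 0"
    using D D' by (auto simp: coordinate_disk_def)
  note op = chart_onD(1)[OF ch(1)] chart_onD(1)[OF ch(2)]
  then have "p \<in> topspace Sc" using p openin_subset by blast
  then obtain U \<phi> where c: "(U, \<phi>) \<in> R" "p \<in> U"
    using R by (auto simp: surface_with_boundary_def)
  have chU: "chart_on Sc half_plane (U, \<phi>)"
    using R c by (auto simp: surface_with_boundary_def)
  then have U: "openin Sc U" by (auto simp: chart_on_def)
  have t1: "transition_ok (\<lambda>f W. f holomorphic_on W) (D, z) (U, \<phi>)"
    and t2: "transition_ok (\<lambda>f W. f holomorphic_on W) (U, \<phi>) (D', z')"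
    using D D' c by (auto simp: coordinate_disk_def compatible_def)
  obtain W1 K1 where 1: "openin Sc W1" "p \<in> W1" "W1 \<subseteq> D \<inter> U" "0 < K1"
    "\<And>q. q \<in> W1 \<Longrightarrow> norm (\<phi> q - \<phi> p) \<le> K1 * norm (z q - z p)"
    using holomorphic_transition_Lipschitz_at[OF ch(1) U t1, of p] p c by blast
  obtain W2 K2 where 2: "openin Sc W2" "p \<in> W2" "W2 \<subseteq> U \<inter> D'" "0 < K2"
    "\<And>q. q \<in> W2 \<Longrightarrow> norm (z' q - z' p) \<le> K2 * norm (\<phi> q - \<phi> p)"
    using holomorphic_transition_Lipschitz_at[OF chU op(2) t2, of p] p c by blast
  show ?thesis
  proof
    show "openin Sc (W1 \<inter> W2)" "p \<in> W1 \<inter> W2" "W1 \<inter> W2 \<subseteq> D \<inter> D'" "0 < K2 * K1"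
      using 1 2 by (auto intro: openin_Int)
    fix q assume q: "q \<in> W1 \<inter> W2"
    have "norm (z' q - z' p) \<le> K2 * norm (\<phi> q - \<phi> p)" using 2 q by simp
    also have "\<dots> \<le> K2 * (K1 * norm (z q - z p))"
      using 1 2 q by (intro mult_left_mono) auto
    finally show "norm (z' q) \<le> K2 * K1 * norm (z q)" using z0 by simp
  qed
qed

section \<open>Growth of the position map at a puncture\<close>

text \<open>The multiplicity provides some coordinate with the right growth, whereas the weight is
  tested in a prescribed one. Comparing the two coordinates in both directions transfers the growth
  at the cost of constants.\<close>

lemma end_multiplicity_growth_near:
  assumes R: "riemann_surface Sc R" and "end_multiplicity Sc R X p d"
    and D: "coordinate_disk Sc R p D z"
  obtains \<epsilon> c C where "0 < \<epsilon>" "0 < c" "0 < C"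
    "\<And>q. q \<in> D \<Longrightarrow> 0 < norm (z q) \<Longrightarrow> norm (z q) < \<epsilon> \<Longrightarrow>
       c / norm (z q) ^ d \<le> norm (X q) \<and> norm (X q) \<le> C / norm (z q) ^ d"
proof -
  obtain D' z' where D': "coordinate_disk Sc R p D' z'"
    and th: "(\<lambda>w. norm (X (inv_into D' z' w))) \<in> \<Theta>[at 0](\<lambda>w. 1 / norm w ^ d)"
    using assms(2) by (auto simp: end_multiplicity_def)
  from th obtain C0 where C0: "0 < C0"
    "\<forall>\<^sub>F w in at 0. norm (X (inv_into D' z' w)) \<le> C0 * (1 / norm w ^ d)"
    unfolding bigtheta_def by (auto elim!: landau_o.bigE)
  from th obtain c0 where c0: "0 < c0"
    "\<forall>\<^sub>F w in at 0. norm (X (inv_into D' z' w)) \<ge> c0 * (1 / norm w ^ d)"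
    unfolding bigtheta_def by (auto elim!: landau_omega.bigE)
  have "\<forall>\<^sub>F w in at 0. c0 * (1 / norm w ^ d) \<le> norm (X (inv_into D' z' w)) \<and>
      norm (X (inv_into D' z' w)) \<le> C0 * (1 / norm w ^ d)"
    using C0 c0 by (intro eventually_conj)
  then obtain \<delta> where \<delta>: "0 < \<delta>" "\<And>w. w \<noteq> 0 \<Longrightarrow> norm w < \<delta> \<Longrightarrow>
      c0 * (1 / norm w ^ d) \<le> norm (X (inv_into D' z' w)) \<and>
      norm (X (inv_into D' z' w)) \<le> C0 * (1 / norm w ^ d)"
    unfolding eventually_at by auto
  have ch: "chart_on Sc UNIV (D, z)" "chart_on Sc UNIV (D', z')" and p: "p \<in> D" "p \<in> D'"
    and z0: "z p = 0" "z' p = 0"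
    using D D' by (auto simp: coordinate_disk_def)
  note op = chart_onD(1)[OF ch(1)] chart_onD(1)[OF ch(2)]
    and hom = chart_onD(3)[OF ch(1)] chart_onD(3)[OF ch(2)]
    and tops = chart_onD(4)[OF ch(1)] chart_onD(4)[OF ch(2)]
    and inj = chart_onD(5)[OF ch(1)] chart_onD(5)[OF ch(2)]
  have zD: "open (z ` D)" using chart_onD(2)[OF ch(1)] by simp
  obtain W1 K1 where 1: "openin Sc W1" "p \<in> W1" "W1 \<subseteq> D \<inter> D'" "0 < K1"
    "\<And>q. q \<in> W1 \<Longrightarrow> norm (z' q) \<le> K1 * norm (z q)"
    using coordinate_disks_comparable[OF R D D'] by blast
  obtain W2 K2 where 2: "openin Sc W2" "p \<in> W2" "W2 \<subseteq> D' \<inter> D" "0 < K2"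
    "\<And>q. q \<in> W2 \<Longrightarrow> norm (z q) \<le> K2 * norm (z' q)"
    using coordinate_disks_comparable[OF R D' D] by blast
  \<comment> \<open>The points where the estimates in the coordinate \<open>z'\<close> hold.
    Intersected with both comparison neighbourhoods, this set has an open image under
    \<open>z\<close>, and a ball about \<open>0\<close> in that image supplies the radius.\<close>
  define V where "V = {q \<in> topspace (subtopology Sc D'). z' q \<in> z' ` D' \<inter> ball 0 \<delta>}"
  have "openin (subtopology Sc D') V"
    unfolding V_def using homeomorphic_imp_continuous_map[OF hom(2)]
    by (rule openin_continuous_map_preimage) (auto intro: openin_open_Int)
  then have V: "openin Sc V" using op(2) by (rule openin_trans_full)
  define W where "W = W1 \<inter> W2 \<inter> V"
  have W: "openin Sc W" unfolding W_def using 1(1) 2(1) V by (intro openin_Int)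
  have WD: "W \<subseteq> D" using 1(3) by (auto simp: W_def)
  have "openin (subtopology Sc D) W"
    using op(1) W WD by (simp add: openin_open_subtopology)
  then have "openin (top_of_set (z ` D)) (z ` W)"
    using homeomorphic_imp_open_map[OF hom(1)] by (simp add: open_map_def)
  then have "open (z ` W)" using zD by (rule openin_open_trans)
  moreover have "p \<in> W"
    unfolding W_def V_def tops using p z0 1(2) 2(2) \<delta>(1) by simp
  then have "0 \<in> z ` W" using z0(1) by (metis imageI)
  ultimately obtain \<epsilon> where \<epsilon>: "0 < \<epsilon>" "ball 0 \<epsilon> \<subseteq> z ` W"
    unfolding open_contains_ball by blast
  show ?thesis
  proof
    show "0 < \<epsilon>" "0 < c0 / K1 ^ d" "0 < C0 * K2 ^ d"
      using \<epsilon>(1) c0(1) C0(1) 1(4) 2(4) by auto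
    fix q assume q: "q \<in> D" "0 < norm (z q)" "norm (z q) < \<epsilon>"
    then have "z q \<in> z ` W" using \<epsilon>(2) by auto
    then obtain q' where "q' \<in> W" "z q = z q'" by blast
    then have "q \<in> W" using inj_onD[OF inj(1)] q(1) WD by blast
    then have qW: "q \<in> W1" "q \<in> W2" "q \<in> V" by (auto simp: W_def)
    have "q \<noteq> p" using q z0 by auto
    have q': "q \<in> D'" "norm (z' q) < \<delta>" using qW(3) unfolding V_def tops by auto
    then have "z' q \<noteq> 0" using \<open>q \<noteq> p\<close> z0(2) inj_onD[OF inj(2)] p(2) by metis
    then have X: "c0 / norm (z' q) ^ d \<le> norm (X q)" "norm (X q) \<le> C0 / norm (z' q) ^ d"
      using \<delta>(2)[of "z' q"] q' inv_into_f_f[OF inj(2) q'(1)] by auto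
    \<comment> \<open>An upper bound for \<open>norm (z' q)\<close> is a lower bound for its
      negative powers; hence \<open>K1\<close> enters the lower constant and \<open>K2\<close> the
      upper one.\<close>
    have "norm (z' q) ^ d \<le> (K1 * norm (z q)) ^ d" using 1(5) qW(1) by (intro power_mono) auto
    then have "c0 / (K1 * norm (z q)) ^ d \<le> c0 / norm (z' q) ^ d"
      using \<open>z' q \<noteq> 0\<close> q(2) c0(1) 1(4) by (intro divide_left_mono) auto
    moreover have "norm (z q) ^ d \<le> (K2 * norm (z' q)) ^ d" using 2(5) qW(2) by (intro power_mono) auto
    then have "C0 * K2 ^ d / (K2 * norm (z' q)) ^ d \<le> C0 * K2 ^ d / norm (z q) ^ d"
      using \<open>z' q \<noteq> 0\<close> q(2) C0(1) 2(4) by (intro divide_left_mono) auto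
    ultimately show "c0 / K1 ^ d / norm (z q) ^ d \<le> norm (X q) \<and>
        norm (X q) \<le> C0 * K2 ^ d / norm (z q) ^ d"
      using X 2(4) by (simp add: power_mult_distrib)
  qed
qed

text \<open>Away from the puncture \<open>X\<close> may vanish, so \<open>norm (X q)\<close> itself
  need not be bounded below by a power of the coordinate; adding \<open>1\<close> to both sides
  makes the comparison hold on the whole disk of radius \<open>R1\<close>.\<close>

lemma end_multiplicity_growth:
  assumes R: "riemann_surface Sc R" and mult: "end_multiplicity Sc R X p d"
    and D: "coordinate_disk Sc R p D z"
    and X: "continuous_map (subtopology Sc (D - {p})) euclidean X"
    and R1: "cball 0 R1 \<subseteq> z ` D"
  obtains K where "1 \<le> K"
    "\<And>q. q \<in> D \<Longrightarrow> 0 < norm (z q) \<Longrightarrow> norm (z q) \<le> R1 \<Longrightarrow>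
       1 + norm (X q) \<le> K * (1 + 1 / norm (z q) ^ d) \<and>
       1 + 1 / norm (z q) ^ d \<le> K * (1 + norm (X q))"
proof -
  obtain \<epsilon> c C where near: "0 < \<epsilon>" "0 < c" "0 < C"
    "\<And>q. q \<in> D \<Longrightarrow> 0 < norm (z q) \<Longrightarrow> norm (z q) < \<epsilon> \<Longrightarrow>
       c / norm (z q) ^ d \<le> norm (X q) \<and> norm (X q) \<le> C / norm (z q) ^ d"
    using end_multiplicity_growth_near[OF R mult D] by blast
  have ch: "chart_on Sc UNIV (D, z)" and p: "p \<in> D" "z p = 0"
    using D by (auto simp: coordinate_disk_def)
  note hom = chart_onD(3)[OF ch] and tops = chart_onD(4)[OF ch]
  obtain g where g: "homeomorphic_maps (subtopology Sc D) (top_of_set (z ` D)) z g"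
    using hom by (auto simp: homeomorphic_map_maps)
  \<comment> \<open>The compact annulus left over by the local estimate. The inverse coordinate maps
    it into \<open>D - {p}\<close>, where \<open>X\<close> is continuous and hence bounded.\<close>
  let ?A = "cball 0 R1 - ball 0 \<epsilon> :: complex set"
  have gz: "g (z q) = q" if "q \<in> D" for q
    using g that unfolding homeomorphic_maps_def tops by blast
  have zg: "z (g w) = w" "g w \<in> D" if "w \<in> z ` D" for w using that gz by auto
  have "continuous_map (top_of_set (z ` D)) (subtopology Sc D) g"
    using g by (auto simp: homeomorphic_maps_def)
  then have "continuous_map (top_of_set (z ` D)) Sc g"
    by (simp add: continuous_map_in_subtopology)
  then have "continuous_map (subtopology (top_of_set (z ` D)) ?A) Sc g"
    by (rule continuous_map_from_subtopology)
  moreover have "z ` D \<inter> ?A = ?A" using R1 by blast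
  ultimately have "continuous_map (top_of_set ?A) Sc g"
    by (simp add: subtopology_subtopology)
  moreover have "g ` ?A \<subseteq> D - {p}"
  proof
    fix y assume "y \<in> g ` ?A"
    then obtain w where w: "w \<in> ?A" "y = g w" by blast
    then have "w \<in> z ` D" using R1 by auto
    then have "z y = w" "y \<in> D" using zg w by auto
    moreover have "w \<noteq> 0" using w near(1) by auto
    ultimately show "y \<in> D - {p}" using p by auto
  qed
  ultimately have "continuous_map (top_of_set ?A) (subtopology Sc (D - {p})) g"
    by (auto simp: continuous_map_in_subtopology)
  then have "continuous_map (top_of_set ?A) euclidean (X \<circ> g)"
    using X by (rule continuous_map_compose)
  then have "continuous_on ?A (X \<circ> g)" by simp
  then have "compact ((X \<circ> g) ` ?A)"
    by (rule compact_continuous_image) (simp add: compact_diff)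
  then obtain B where B: "0 < B" "\<And>w. w \<in> ?A \<Longrightarrow> norm (X (g w)) \<le> B"
    using compact_imp_bounded bounded_pos by (metis comp_apply imageI)
  \<comment> \<open>\<open>C\<close> and \<open>1 / c\<close> serve near the puncture,
    \<open>B\<close> and the inverse power of the inner radius on the annulus; the summand
    \<open>1\<close> absorbs the added \<open>1\<close> there.\<close>
  define K where "K = 1 + B + 1 / \<epsilon> ^ d + C + 1 / c"
  have e: "0 < 1 / \<epsilon> ^ d" and c: "0 < 1 / c" using near by auto
  show ?thesis
  proof
    show K: "1 \<le> K" unfolding K_def using B(1) near(3) e c by linarith
    fix q assume q: "q \<in> D" "0 < norm (z q)" "norm (z q) \<le> R1"
    let ?t = "1 / norm (z q) ^ d"
    have t: "0 < ?t" using q by simp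
    show "1 + norm (X q) \<le> K * (1 + ?t) \<and> 1 + ?t \<le> K * (1 + norm (X q))"
    proof (cases "norm (z q) < \<epsilon>")
      case True
      then have b: "c * ?t \<le> norm (X q)" "norm (X q) \<le> C * ?t" using near(4)[of q] q by auto
      have "C \<le> K" "1 / c \<le> K" unfolding K_def using B(1) near(3) e c by linarith+
      then have "C * ?t \<le> K * ?t" "1 / c * norm (X q) \<le> K * norm (X q)"
        using mult_right_mono[of C K ?t] mult_right_mono[of "1 / c" K "norm (X q)"] t by auto
      moreover have "?t \<le> 1 / c * norm (X q)" using b(1) near(2) by (simp add: field_simps)
      ultimately show ?thesis using b(2) K by (simp add: distrib_left)
    next
      case False
      then have "norm (X q) \<le> B" using B(2)[of "z q"] gz q by auto
      moreover have "?t \<le> 1 / \<epsilon> ^ d"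
        using False near(1) q by (intro divide_left_mono power_mono mult_pos_pos) auto
      ultimately have "1 + norm (X q) \<le> K" "1 + ?t \<le> K"
        unfolding K_def using B(1) near(3) e c by linarith+
      moreover have "K * 1 \<le> K * (1 + ?t)" "K * 1 \<le> K * (1 + norm (X q))"
        using K t by (intro mult_left_mono; simp)+
      ultimately show ?thesis by linarith
    qed
  qed
qed

section \<open>Radial profiles of the weight\<close>

lemma radial_profile_log_weight:
  assumes "finite J" "0 < R1"
    and growth: "\<And>j. j \<in> J \<Longrightarrow> \<exists>K\<ge>1. \<forall>q\<in>D j. 0 < norm (z j q) \<and> norm (z j q) \<le> R1 \<longrightarrow>
       1 + norm (X q) \<le> K * (1 + 1 / norm (z j q) ^ d j) \<and>
       1 + 1 / norm (z j q) ^ d j \<le> K * (1 + norm (X q))"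
  shows "radial_profile J D z R1 (log_weight \<circ> X) (\<lambda>j r. log_profile (1 / r ^ d j))"
proof -
  obtain K where K: "\<And>j. j \<in> J \<Longrightarrow> 1 \<le> K j"
    "\<And>j q. j \<in> J \<Longrightarrow> q \<in> D j \<Longrightarrow> 0 < norm (z j q) \<Longrightarrow> norm (z j q) \<le> R1 \<Longrightarrow>
       1 + norm (X q) \<le> K j * (1 + 1 / norm (z j q) ^ d j) \<and>
       1 + 1 / norm (z j q) ^ d j \<le> K j * (1 + norm (X q))"
    using growth by metis
  \<comment> \<open>A radial profile needs constants common to all punctures. The sum dominates
    every \<open>K j\<close> as \<open>J\<close> is finite, and the summand \<open>1\<close> gives
    \<open>L >= 1\<close> even for empty \<open>J\<close>.\<close>
  define L where "L = 1 + (\<Sum>j\<in>J. K j)"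
  have KL: "K j \<le> L" if "j \<in> J" for j
    using member_le_sum[OF that, of K] K(1) assms(1) unfolding L_def by fastforce
  have L1: "1 \<le> L" using K(1) unfolding L_def by (smt (verit) sum_nonneg)
  define C where "C = 2 * L\<^sup>2 * (1 + ln L / ln 2)\<^sup>2"
  have "1 * 1 \<le> L\<^sup>2 * (1 + ln L / ln 2)\<^sup>2"
    using L1 by (intro mult_mono one_le_power) auto
  then have C: "1 \<le> C" by (simp add: C_def)
  have cont: "continuous_on {0<..R1} (\<lambda>r. log_profile (1 / r ^ d j))" for j
    by (rule continuous_on_compose2[OF continuous_on_log_profile])
       (auto intro!: continuous_intros)
  have "1 / C * log_profile (1 / norm (z j q) ^ d j) \<le> log_weight (X q) \<and>
        log_weight (X q) \<le> C * log_profile (1 / norm (z j q) ^ d j)"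
    if q: "j \<in> J" "q \<in> D j" "0 < norm (z j q)" "norm (z j q) \<le> R1" for j q
  proof -
    let ?t = "1 / norm (z j q) ^ d j"
    have t: "0 \<le> ?t" by simp
    have "1 + norm (X q) \<le> L * (1 + ?t)" "1 + ?t \<le> L * (1 + norm (X q))"
      using K(2)[OF q] KL[OF q(1)] t mult_right_mono[of "K j" L "1 + ?t"]
        mult_right_mono[of "K j" L "1 + norm (X q)"] by auto
    then have "log_profile ?t \<le> C * log_profile (norm (X q))"
      "log_profile (norm (X q)) \<le> C * log_profile ?t"
      using L1 t unfolding C_def by (intro log_profile_comparable; simp)+
    then show ?thesis using C by (simp add: log_weight_eq field_simps)
  qed
  moreover have "1 / C \<le> C" using C by (simp add: field_simps mult_ge1_I)
  moreover have "0 < 1 / C" using C by simp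
  moreover have "(\<lambda>r. log_profile (1 / r ^ d j)) \<in> borel_measurable (lebesgue_on {0<..R1})" for j
    using cont by (rule continuous_imp_measurable_on_sets_lebesgue) simp
  ultimately show ?thesis
    unfolding radial_profile_def
    by (intro conjI ballI exI[of _ "1 / C"] exI[of _ C]) (auto intro!: log_profile_pos)
qed

text \<open>Every radius up to \<open>R1\<close> is attained by a point of the disk, namely the one
  with that real coordinate. There both profiles are comparable to the same value of the weight.
  This makes the local order independent of the profile.\<close>

lemma radial_profiles_comparable:
  assumes h: "radial_profile J D z R1 \<rho> h" and k: "radial_profile J D z R1 \<rho> k"
    and R1: "\<And>j. j \<in> J \<Longrightarrow> cball 0 R1 \<subseteq> z j ` D j"
  obtains c C where "0 < c"
    "\<And>j r. j \<in> J \<Longrightarrow> r \<in> {0<..R1} \<Longrightarrow> c * k j r \<le> h j r \<and> h j r \<le> C * k j r"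
proof -
  obtain c C where c: "0 < c" "c \<le> C"
    "\<And>j q. j \<in> J \<Longrightarrow> q \<in> D j \<Longrightarrow> 0 < norm (z j q) \<Longrightarrow> norm (z j q) \<le> R1 \<Longrightarrow>
       c * h j (norm (z j q)) \<le> \<rho> q \<and> \<rho> q \<le> C * h j (norm (z j q))"
    using h unfolding radial_profile_def by metis
  obtain c' C' where c': "0 < c'" "c' \<le> C'"
    "\<And>j q. j \<in> J \<Longrightarrow> q \<in> D j \<Longrightarrow> 0 < norm (z j q) \<Longrightarrow> norm (z j q) \<le> R1 \<Longrightarrow>
       c' * k j (norm (z j q)) \<le> \<rho> q \<and> \<rho> q \<le> C' * k j (norm (z j q))"
    using k unfolding radial_profile_def by metis
  show ?thesis
  proof
    show "0 < c' / C" using c c' by simp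
    fix j r assume j: "j \<in> J" and r: "r \<in> {0<..R1}"
    have "complex_of_real r \<in> z j ` D j" using R1[OF j] r by auto
    then obtain q where "q \<in> D j" "z j q = complex_of_real r" by force
    then have "c * h j r \<le> \<rho> q \<and> \<rho> q \<le> C * h j r" "c' * k j r \<le> \<rho> q \<and> \<rho> q \<le> C' * k j r"
      using c(3)[OF j, of q] c'(3)[OF j, of q] r by auto
    then have "c' * k j r \<le> C * h j r" "c * h j r \<le> C' * k j r" by linarith+
    then show "c' / C * k j r \<le> h j r \<and> h j r \<le> C' / c * k j r"
      using c(1,2) by (simp add: field_simps)
  qed
qed

section \<open>Global bounds for the weight and the conclusion\<close>

lemma log_weight_le: "log_weight x \<le> 1 / (ln 2)\<^sup>2"
proof -
  have "1 * (ln 2)\<^sup>2 \<le> (1 + (norm x)\<^sup>2) * (ln (2 + norm x))\<^sup>2"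
    by (intro mult_mono power_mono ln_2_add_ge) auto
  then show ?thesis unfolding log_weight_def
    by (intro divide_left_mono mult_pos_pos zero_less_power ln_gt_zero) (auto simp: add_pos_nonneg)
qed

lemma log_weight_pos: "0 < log_weight x"
  by (simp add: log_weight_eq log_profile_pos)

lemma continuous_on_log_weight: "continuous_on UNIV log_weight"
  unfolding log_weight_eq[abs_def]
  by (rule continuous_on_compose2[OF continuous_on_log_profile continuous_on_norm_id]) auto

theorem lemma5p1:
  fixes \<Omega> :: "(real^3) set"
    and S :: "'a topology" and A :: "'a chart set" and X N :: "'a \<Rightarrow> real^3"
    and Sc :: "'a topology" and R :: "'a chart set"
    and r :: nat and p :: "nat \<Rightarrow> 'a" and d :: "nat \<Rightarrow> nat"
    and D :: "nat \<Rightarrow> 'a set" and z :: "nat \<Rightarrow> 'a \<Rightarrow> complex" and R1 :: real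
  assumes "smooth_domain \<Omega>" and "\<not> bounded \<Omega>"
    and "smooth_surface S A" and "connected_space S" and "\<not> compact_space S"
    and "orientable_surface S A" and "complete_surface S X"
    and "free_boundary_minimal \<Omega> S A X N"
    and "surface_boundary A \<noteq> {}" and "compactin S (surface_boundary A)"
    and "morse_index \<Omega> S A X N < \<infinity>"
    and "inj_on p {1..r}"
    and "conformal_compactification Sc R (p ` {1..r}) S A X"
    and "\<forall>j\<in>{1..r}. end_multiplicity Sc R X (p j) (d j)"
    and "\<forall>j\<in>{1..r}. coordinate_disk Sc R (p j) (D j) (z j)"
    and "disjoint_family_on D {1..r}"
    and "R1 > 0" and "\<forall>j\<in>{1..r}. cball 0 R1 \<subseteq> z j ` D j"
  shows "admissible Sc S {1..r} D z R1 (log_weight \<circ> X) \<and>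
         (\<forall>h. radial_profile {1..r} D z R1 (log_weight \<circ> X) h \<longrightarrow>
              (\<forall>j\<in>{1..r}. local_order R1 (h j) = d j + 1))"
proof -
  note R1 = \<open>R1 > 0\<close> and disks = \<open>\<forall>j\<in>{1..r}. coordinate_disk Sc R (p j) (D j) (z j)\<close>
    and mult = \<open>\<forall>j\<in>{1..r}. end_multiplicity Sc R X (p j) (d j)\<close>
    and cballs = \<open>\<forall>j\<in>{1..r}. cball 0 R1 \<subseteq> z j ` D j\<close>
  have riem: "riemann_surface Sc R" and comp: "compact_space Sc"
    and S: "S = subtopology Sc (topspace Sc - p ` {1..r})"
    using \<open>conformal_compactification Sc R (p ` {1..r}) S A X\<close>
    by (auto simp: conformal_compactification_def)
  have "smooth_map A X"
    using \<open>free_boundary_minimal \<Omega> S A X N\<close> by (simp add: free_boundary_minimal_def immersion_def)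
  then have X: "continuous_map S euclidean X"
    by (rule smooth_map_imp_continuous_map[OF \<open>smooth_surface S A\<close>])
  have Dop: "openin Sc (D j)" and pD: "p j \<in> D j" if "j \<in> {1..r}" for j
    using disks that by (auto simp: coordinate_disk_def chart_on_def)
  \<comment> \<open>The disks are disjoint and each contains its own puncture, so \<open>D j\<close>
    meets no other puncture and \<open>D j - {p j}\<close> lies in \<open>S\<close>.\<close>
  have XD: "continuous_map (subtopology Sc (D j - {p j})) euclidean X" if j: "j \<in> {1..r}" for j
  proof -
    have "i = j" if "i \<in> {1..r}" "p i \<in> D j" for i
      using \<open>disjoint_family_on D {1..r}\<close> pD[OF that(1)] that j
      unfolding disjoint_family_on_def by blast
    then have "D j - {p j} \<subseteq> topspace Sc - p ` {1..r}"
      using openin_subset[OF Dop[OF j]] by blast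
    then have "subtopology S (D j - {p j}) = subtopology Sc (D j - {p j})"
      by (simp add: S subtopology_subtopology Int_absorb1)
    then show ?thesis using continuous_map_from_subtopology[OF X] by metis
  qed
  have growth: "\<exists>K\<ge>1. \<forall>q\<in>D j. 0 < norm (z j q) \<and> norm (z j q) \<le> R1 \<longrightarrow>
       1 + norm (X q) \<le> K * (1 + 1 / norm (z j q) ^ d j) \<and>
       1 + 1 / norm (z j q) ^ d j \<le> K * (1 + norm (X q))" if j: "j \<in> {1..r}" for j
    using end_multiplicity_growth[OF riem _ _ XD[OF j], of "d j" "z j" R1] mult disks cballs j
    by metis
  have prof: "radial_profile {1..r} D z R1 (log_weight \<circ> X) (\<lambda>j r. log_profile (1 / r ^ d j))"
    by (rule radial_profile_log_weight[OF _ R1 growth]) auto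
  \<comment> \<open>Stated for an arbitrary profile: applied to the standard one it yields
    admissibility, in general the value of the local order.\<close>
  have orders: "integrable_orders R1 (h j) = {..d j + 1}"
    if h: "radial_profile {1..r} D z R1 (log_weight \<circ> X) h" and j: "j \<in> {1..r}" for h j
  proof -
    obtain c C where c: "0 < c" "\<And>j s. j \<in> {1..r} \<Longrightarrow> s \<in> {0<..R1} \<Longrightarrow>
        c * log_profile (1 / s ^ d j) \<le> h j s \<and> h j s \<le> C * log_profile (1 / s ^ d j)"
      using radial_profiles_comparable[OF h prof] cballs by blast
    have "0 < d j" using bspec[OF mult j] by (auto simp: end_multiplicity_def)
    then show ?thesis using c(2)[OF j] by (rule integrable_orders_log_profile[OF _ R1 c(1)])
  qed
  have cont: "continuous_map S euclideanreal (log_weight \<circ> X)"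
    using X continuous_on_log_weight by (intro continuous_map_compose) auto
  \<comment> \<open>The complement of the open disks is compact in \<open>Sc\<close> and contains no
    puncture, so it is compact in \<open>S\<close> as well. The continuous positive weight attains
    its minimum there; if the complement is empty, any positive number will do.\<close>
  have away: "\<exists>\<epsilon>>0. \<forall>q \<in> topspace Sc - (\<Union>j\<in>{1..r}. D j). \<epsilon> \<le> (log_weight \<circ> X) q"
  proof -
    let ?E = "topspace Sc - (\<Union>j\<in>{1..r}. D j)"
    have "openin Sc (\<Union>j\<in>{1..r}. D j)" using Dop by blast
    then have "compactin Sc ?E" using comp by (intro closedin_compact_space) auto
    moreover have "?E \<subseteq> topspace Sc - p ` {1..r}" using pD by auto
    ultimately have "compactin S ?E" by (simp add: S compactin_subtopology)
    then have cp: "compact ((log_weight \<circ> X) ` ?E)"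
      using image_compactin[OF _ cont] by fastforce
    show ?thesis
    proof (cases "?E = {}")
      case False
      then obtain q where "q \<in> ?E" "\<forall>q'\<in>?E. (log_weight \<circ> X) q \<le> (log_weight \<circ> X) q'"
        using compact_attains_inf[OF cp] by auto
      then show ?thesis using log_weight_pos by (intro exI[of _ "(log_weight \<circ> X) q"]) auto
    qed (auto intro: zero_less_one)
  qed
  have "bounded ((log_weight \<circ> X) ` topspace S)"
    unfolding bounded_iff using log_weight_le log_weight_pos
    by (intro exI[of _ "1 / (ln 2)\<^sup>2"]) (auto simp: less_imp_le)
  then have "admissible Sc S {1..r} D z R1 (log_weight \<circ> X)"
    unfolding admissible_def using cont away prof orders[OF prof] log_weight_pos
    by (intro conjI exI[of _ "\<lambda>j r. log_profile (1 / r ^ d j)"]) auto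
  moreover have "local_order R1 (h j) = d j + 1"
    if "radial_profile {1..r} D z R1 (log_weight \<circ> X) h" "j \<in> {1..r}" for h j
  proof -
    have "Max {..d j + 1} = d j + 1" by (intro Max_eqI) auto
    then show ?thesis unfolding local_order_def orders[OF that] .
  qed
  ultimately show ?thesis by blast
qed

end
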